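(* Let $N$ be a positive integer and let $X_0,X_1,X_2,X_3>0$ satisfy $X_0+X_1+X_2+X_3=1$ with $NX_0,NX_1,NX_2,NX_3$ integers. Consider the $2\times2$ contingency table with first row $(NX_0,\,NX_1)$ and second row $(NX_2,\,NX_3)$, let $P_F$ be its Fisher exact-test $p$-value with fixed margins, and let $MI$ be its mutual information. Then $$MI+\frac{1}{N}\left[-\log(N+1)-\frac{3}{2}\log(N+1)+\frac{1}{12(N+1)}-\frac{1}{2N}-0.735\right]<-\frac{1}{N}\log P_F<MI+\frac{1}{2N}\log(N+1)+\frac{5.253}{N}.$$
   Context: All logarithms are natural. The mutual information of the $2\times 2$ table is $$MI= X_0\log\frac{X_0}{(X_0+X_2)(X_0+X_1)}+X_1\log\frac{X_1}{(X_1+X_3)(X_0+X_1)}+X_2\log\frac{X_2}{(X_0+X_2)(X_2+X_3)}+X_3\log\frac{X_3}{(X_1+X_3)(X_2+X_3)}.$$ Let $r_1=N(X_0+X_1)$, $r_2=N(X_2+X_3)$ be the row totals and $c_1=N(X_0+X_2)$, $c_2=N(X_1+X_3)$ the column totals. For a table $y$ of non-negative integers with rows $(y_0,y_1)$, $(y_2,y_3)$ and the same row and column totals, put $$P_C(y)=\frac{r_1!\,r_2!\,c_1!\,c_2!}{N!\,y_0!\,y_1!\,y_2!\,y_3!}.$$ Let $P_H=P_C(NX_0,NX_1,NX_2,NX_3)$ be the hypergeometric probability of the observed table. Fisher's exact (two-sided) $p$-value is $$P_F=\sum_{y:\;P_C(y)\le P_H}P_C(y),$$ the sum running over all tables $y$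 of non-negative integers with row totals $r_1,r_2$ and column totals $c_1,c_2$ satisfying $P_C(y)\le P_H$. *)

theory Defs
  imports Complex_Main
begin

definition mutual_information :: "real \<Rightarrow> real \<Rightarrow> real \<Rightarrow> real \<Rightarrow> real" where
  "mutual_information X0 X1 X2 X3 =
     X0 * ln (X0 / ((X0 + X2) * (X0 + X1)))
   + X1 * ln (X1 / ((X1 + X3) * (X0 + X1)))
   + X2 * ln (X2 / ((X0 + X2) * (X2 + X3)))
   + X3 * ln (X3 / ((X1 + X3) * (X2 + X3)))"

text \<open>A tuple \<open>(y0, y1, y2, y3)\<close> is the table with rows \<open>(y0, y1)\<close> and \<open>(y2, y3)\<close>.\<close>

type_synonym table = "nat \<times> nat \<times> nat \<times> nat"

fun row1 :: "table \<Rightarrow> nat" where "row1 (y0, y1, y2, y3) = y0 + y1"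
fun row2 :: "table \<Rightarrow> nat" where "row2 (y0, y1, y2, y3) = y2 + y3"
fun col1 :: "table \<Rightarrow> nat" where "col1 (y0, y1, y2, y3) = y0 + y2"
fun col2 :: "table \<Rightarrow> nat" where "col2 (y0, y1, y2, y3) = y1 + y3"
fun total :: "table \<Rightarrow> nat" where "total (y0, y1, y2, y3) = y0 + y1 + y2 + y3"

definition same_margins :: "table \<Rightarrow> table set" where
  "same_margins x =
     {y. row1 y = row1 x \<and> row2 y = row2 x \<and> col1 y = col1 x \<and> col2 y = col2 x}"

text \<open>The margins in \<open>P_C\<close> are read off its own argument; on \<open>same_margins x\<close>
  they are those of \<open>x\<close>.\<close>

fun P_C :: "table \<Rightarrow> real" where
  "P_C (y0, y1, y2, y3) =
     (fact (row1 (y0, y1, y2, y3)) * fact (row2 (y0, y1, y2, y3)) *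
      fact (col1 (y0, y1, y2, y3)) * fact (col2 (y0, y1, y2, y3)))
     / (fact (total (y0, y1, y2, y3)) * fact y0 * fact y1 * fact y2 * fact y3)"

definition P_F :: "table \<Rightarrow> real" where
  "P_F x = (\<Sum>y \<in> {y \<in> same_margins x. P_C y \<le> P_C x}. P_C y)"

lemma finite_same_margins: "finite (same_margins x)"
proof (rule finite_subset)
  show "same_margins x \<subseteq> {..row1 x} \<times> {..row1 x} \<times> {..row2 x} \<times> {..row2 x}"
    by (cases x) (auto simp: same_margins_def)
qed simp

end

theory Submission
  imports Defs "HOL-Analysis.Harmonic_Numbers"
begin

text \<open>By Stirling's formula \<open>ln P\<^sub>H\<close> equals \<open>- N MI\<close> plus half the logarithm of
  \<open>r\<^sub>1 r\<^sub>2 c\<^sub>1 c\<^sub>2 / (N y\<^sub>0 y\<^sub>1 y\<^sub>2 y\<^sub>3)\<close>, which lies between \<open>1 / N\<close> and \<open>N\<close>, plus bounded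
  terms. Moreover \<open>P\<^sub>H \<le> P\<^sub>F \<le> (N + 1) P\<^sub>H\<close>, since a table with given margins is
  determined by its first entry.\<close>

section \<open>Stirling's formula with explicit bounds on the remainder\<close>

definition stirling_rem :: "nat \<Rightarrow> real" where
  "stirling_rem n = ln (fact n) - (real n + 1 / 2) * ln (real n) + real n"

lemma ln_fact_eq_stirling_rem:
  "ln (fact n) = real n * ln (real n) - real n + ln (real n) / 2 + stirling_rem n"
  by (simp add: stirling_rem_def algebra_simps)

lemma stirling_rem_diff:
  assumes "n > 0"
  shows "stirling_rem n - stirling_rem (Suc n)
    = (real n + 1 / 2) * (ln (real n + 1) - ln (real n)) - 1"
proof -
  have "ln (fact (Suc n) :: real) = ln (real n + 1) + ln (fact n)"
    using assms by (simp add: ln_mult add.commute)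
  then show ?thesis
    by (simp add: stirling_rem_def algebra_simps)
qed

text \<open>Midpoint rule: by convexity of \<open>1 / t\<close>, its integral over
  \<open>[n, n + 1]\<close> is at least the value at \<open>n + 1 / 2\<close>. The remainder thus
  decreases; by Stirling its limit is \<open>ln (2 * pi) / 2\<close>, about 0.919.\<close>

lemma stirling_rem_Suc_le:
  assumes "n > 0"
  shows "stirling_rem (Suc n) \<le> stirling_rem n"
proof -
  have "1 / (real n + 1 / 2) \<le> ln (real n + 1) - ln (real n)"
    using ln_inverse_approx_ge[of "real n" "real n + 1"] assms
    by (simp add: field_simps)
  then have "1 \<le> (real n + 1 / 2) * (ln (real n + 1) - ln (real n))"
    by (simp add: field_simps)
  then show ?thesis
    using stirling_rem_diff[OF assms] by linarith
qed

text \<open>Trapezoidal rule for the same integral: the drop of the remainder is at most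
  \<open>1 / (4 * n * (n + 1))\<close>, which telescopes. The correction \<open>1 / (4 * n)\<close>
  therefore turns the decreasing sequence into an increasing one.\<close>

lemma stirling_rem_Suc_ge:
  assumes "n > 0"
  shows "stirling_rem n - 1 / (4 * real n) \<le> stirling_rem (Suc n) - 1 / (4 * real (Suc n))"
proof -
  have "ln (real n + 1) - ln (real n) \<le> (inverse (real n) + inverse (real n + 1)) / 2"
    using ln_inverse_approx_le[of "real n" 1] assms by simp
  then have "(real n + 1 / 2) * (ln (real n + 1) - ln (real n))
      \<le> (real n + 1 / 2) * ((inverse (real n) + inverse (real n + 1)) / 2)"
    by (intro mult_left_mono) auto
  also have "\<dots> = 1 + 1 / (4 * real n) - 1 / (4 * (real n + 1))"
    using assms by (simp add: divide_simps) (simp add: algebra_simps)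
  finally show ?thesis
    using stirling_rem_diff[OF assms] by (simp add: add.commute)
qed

text \<open>The decreasing sequence starts at the value 1.\<close>

lemma stirling_rem_le:
  assumes "n > 0"
  shows "stirling_rem n \<le> 1"
  using assms
proof (induction n rule: nat_induct_non_zero)
  case 1
  show ?case by (simp add: stirling_rem_def)
next
  case (Suc n)
  then show ?case using stirling_rem_Suc_le[of n] by linarith
qed

text \<open>The corrected, increasing sequence starts at \<open>1 - 1 / 4\<close>.\<close>

lemma stirling_rem_ge:
  assumes "n > 0"
  shows "3 / 4 \<le> stirling_rem n"
proof -
  have "3 / 4 \<le> stirling_rem n - 1 / (4 * real n)"
    using assms
  proof (induction n rule: nat_induct_non_zero)
    case 1
    show ?case by (simp add: stirling_rem_def)
  next
    case (Suc n)
    then show ?case using stirling_rem_Suc_ge[of n] by linarith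
  qed
  moreover have "0 \<le> 1 / (4 * real n)" by simp
  ultimately show ?thesis by linarith
qed

section \<open>Comparison of the p-value with the probability of the observed table\<close>

lemma P_C_pos: "P_C y > 0"
  by (cases y) simp

lemma P_F_ge: "P_C x \<le> P_F x"
  unfolding P_F_def
proof (rule member_le_sum)
  show "x \<in> {y \<in> same_margins x. P_C y \<le> P_C x}"
    by (simp add: same_margins_def)
qed (use P_C_pos finite_same_margins in \<open>auto intro: less_imp_le\<close>)

text \<open>The margins recover the other three entries from the first one. This crude count is what
  costs a term \<open>ln (N + 1)\<close> in the lower bound for the negative logarithm of the
  p-value.\<close>

lemma card_same_margins_le: "card (same_margins x) \<le> Suc (total x)"
proof -
  have "inj_on fst (same_margins x)"
    by (cases x) (auto simp: inj_on_def same_margins_def)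
  moreover have "fst ` same_margins x \<subseteq> {..total x}"
    by (cases x) (auto simp: same_margins_def)
  ultimately show ?thesis
    using card_inj_on_le[of fst "same_margins x" "{..total x}"] by simp
qed

lemma P_F_le: "P_F x \<le> (real (total x) + 1) * P_C x"
proof -
  let ?S = "{y \<in> same_margins x. P_C y \<le> P_C x}"
  have "P_F x \<le> real (card ?S) * P_C x"
    unfolding P_F_def by (rule sum_bounded_above) simp
  also have "\<dots> \<le> (real (total x) + 1) * P_C x"
  proof (rule mult_right_mono)
    have "card ?S \<le> card (same_margins x)"
      by (intro card_mono finite_same_margins) auto
    then show "real (card ?S) \<le> real (total x) + 1"
      using card_same_margins_le[of x] by linarith
  qed (use P_C_pos[of x] in simp)
  finally show ?thesis .
qed

section \<open>Mutual information and the probability of a table in terms of counts\<close>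

text \<open>The logarithm of a margin occurs once for each of its two cells, so its coefficients add
  up to that margin. The result has the shape of the \<open>k * ln k\<close> terms of Stirling's
  formula.\<close>

lemma mutual_information_counts:
  fixes a b c d :: real
  assumes "a > 0" "b > 0" "c > 0" "d > 0"
  defines "n \<equiv> a + b + c + d"
  shows "n * mutual_information (a / n) (b / n) (c / n) (d / n)
    = a * ln a + b * ln b + c * ln c + d * ln d + n * ln n
      - (a + b) * ln (a + b) - (c + d) * ln (c + d) - (a + c) * ln (a + c) - (b + d) * ln (b + d)"
proof -
  have n: "n > 0" using assms by simp
  \<comment> \<open>Here \<open>q\<close> is the other entry in the column of \<open>p\<close>, and
    \<open>r\<close> the other entry in its row, so one computation serves all four cells.\<close>
  have cell: "n * (p / n * ln (p / n / ((p / n + q / n) * (p / n + r / n))))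
      = p * (ln p + ln n - ln (p + q) - ln (p + r))"
    if "p > 0" "q > 0" "r > 0" for p q r
  proof -
    have "p / n / ((p / n + q / n) * (p / n + r / n)) = p * n / ((p + q) * (p + r))"
    proof -
      have "(p / n + q / n) * (p / n + r / n) = (p + q) * (p + r) / (n * n)"
        by (simp add: add_divide_distrib[symmetric])
      then show ?thesis using n by simp
    qed
    then show ?thesis using that n by (simp add: ln_div ln_mult)
  qed
  have "n * mutual_information (a / n) (b / n) (c / n) (d / n)
      = a * (ln a + ln n - ln (a + c) - ln (a + b)) + b * (ln b + ln n - ln (b + d) - ln (b + a))
      + c * (ln c + ln n - ln (c + a) - ln (c + d)) + d * (ln d + ln n - ln (d + b) - ln (d + c))"
    using cell[of a c b] cell[of b d a] cell[of c a d] cell[of d b c] assms(1-4)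
    by (simp add: mutual_information_def distrib_left add.commute)
  also have "\<dots> = a * ln a + b * ln b + c * ln c + d * ln d + n * ln n
      - (a + b) * ln (a + b) - (c + d) * ln (c + d) - (a + c) * ln (a + c) - (b + d) * ln (b + d)"
    by (simp add: n_def algebra_simps)
  finally show ?thesis .
qed

text \<open>The four cells can be matched with four different margins, each containing its
  cell.\<close>

lemma prod_cells_le_prod_margins:
  fixes a b c d :: real
  assumes "a \<ge> 0" "b \<ge> 0" "c \<ge> 0" "d \<ge> 0"
  shows "a * b * c * d \<le> (a + b) * (c + d) * (a + c) * (b + d)"
proof -
  have "a * d * (c * b) \<le> ((a + b) * (c + d)) * ((a + c) * (b + d))"
    using assms by (intro mult_mono) auto
  then show ?thesis by (simp add: mult_ac)
qed

text \<open>The two pairs of margins are treated differently: the column totals have sum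
  \<open>n\<close>, so their product is at most a quarter of its square, while each row total is at
  most twice the product of its cells. The factors 4 cancel.\<close>

lemma prod_margins_le_prod_cells:
  fixes a b c d :: real
  assumes "a \<ge> 1" "b \<ge> 1" "c \<ge> 1" "d \<ge> 1"
  shows "(a + b) * (c + d) * (a + c) * (b + d) \<le> (a + b + c + d)\<^sup>2 * (a * b * c * d)"
proof -
  have sum_le: "x + y \<le> 2 * (x * y)" if "x \<ge> 1" "y \<ge> 1" for x y :: real
  proof -
    have "0 \<le> (x - 1) * y + x * (y - 1)" using that by simp
    then show ?thesis by (simp add: algebra_simps)
  qed
  have "0 \<le> (a + c - b - d)\<^sup>2" by simp
  then have cols: "(a + c) * (b + d) \<le> (a + b + c + d)\<^sup>2 / 4"
    by (simp add: power2_eq_square algebra_simps)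
  have rows: "(a + b) * (c + d) \<le> (2 * (a * b)) * (2 * (c * d))"
    using assms by (intro mult_mono sum_le) auto
  have "((a + b) * (c + d)) * ((a + c) * (b + d))
      \<le> ((2 * (a * b)) * (2 * (c * d))) * ((a + b + c + d)\<^sup>2 / 4)"
    by (rule mult_mono[OF rows cols]) (use assms in auto)
  then show ?thesis by (simp add: mult_ac)
qed

lemma ln_P_C_bounds:
  fixes a b c d :: nat
  assumes "a > 0" "b > 0" "c > 0" "d > 0"
  defines "n \<equiv> a + b + c + d"
  defines "MI \<equiv> mutual_information (real a / real n) (real b / real n) (real c / real n) (real d / real n)"
  shows "- (real n * MI) - ln (real n) / 2 - 2 \<le> ln (P_C (a, b, c, d))" (is ?lower)
    and "ln (P_C (a, b, c, d)) \<le> - (real n * MI) + ln (real n) / 2 + 1 / 4" (is ?upper)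
proof -
  have n: "n > 0" "real n = real a + real b + real c + real d"
    using assms(1) by (simp_all add: n_def)
  define M where "M = (real a + real b) * (real c + real d) * (real a + real c) * (real b + real d)"
  define C where "C = real a * real b * real c * real d"
  have pos: "M > 0" "C > 0" using assms(1-4) by (simp_all add: M_def C_def)
  have ln_M: "ln M = ln (real a + real b) + ln (real c + real d) + ln (real a + real c) + ln (real b + real d)"
    and ln_C: "ln C = ln (real a) + ln (real b) + ln (real c) + ln (real d)"
    using assms(1-4) by (simp_all add: M_def C_def ln_mult)
  have "ln C \<le> ln M"
    using prod_cells_le_prod_margins[of "real a" "real b" "real c" "real d"] pos
    by (simp add: M_def C_def)
  have "M \<le> (real n)\<^sup>2 * C"
    using prod_margins_le_prod_cells[of "real a" "real b" "real c" "real d"] assms(1-4)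
    by (simp add: M_def C_def n)
  then have "ln M \<le> ln ((real n)\<^sup>2 * C)"
    using pos by simp
  also have "\<dots> = 2 * ln (real n) + ln C"
    using pos n by (simp add: ln_mult ln_realpow)
  finally have "ln M \<le> 2 * ln (real n) + ln C" .
  have MI: "real n * MI = real a * ln (real a) + real b * ln (real b) + real c * ln (real c)
      + real d * ln (real d) + real n * ln (real n)
      - (real a + real b) * ln (real a + real b) - (real c + real d) * ln (real c + real d)
      - (real a + real c) * ln (real a + real c) - (real b + real d) * ln (real b + real d)"
    using mutual_information_counts[of "real a" "real b" "real c" "real d"] assms(1-4)
    by (simp add: MI_def n)
  define G where "G = stirling_rem (a + b) + stirling_rem (c + d) + stirling_rem (a + c)
    + stirling_rem (b + d) - stirling_rem n - stirling_rem a - stirling_rem b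
    - stirling_rem c - stirling_rem d"
  \<comment> \<open>Four remainders enter with a plus sign and five with a minus sign, all between
    3/4 and 1: hence \<open>4 * (3 / 4) - 5\<close> and \<open>4 - 5 * (3 / 4)\<close>.\<close>
  have G: "- 2 \<le> G" "G \<le> 1 / 4"
    using stirling_rem_le[of "a + b"] stirling_rem_le[of "c + d"] stirling_rem_le[of "a + c"]
      stirling_rem_le[of "b + d"] stirling_rem_le[of n] stirling_rem_le[of a]
      stirling_rem_le[of b] stirling_rem_le[of c] stirling_rem_le[of d]
      stirling_rem_ge[of "a + b"] stirling_rem_ge[of "c + d"] stirling_rem_ge[of "a + c"]
      stirling_rem_ge[of "b + d"] stirling_rem_ge[of n] stirling_rem_ge[of a]
      stirling_rem_ge[of b] stirling_rem_ge[of c] stirling_rem_ge[of d] assms(1-4) n(1)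
    unfolding G_def by linarith+
  have "ln (P_C (a, b, c, d)) = ln (fact (a + b)) + ln (fact (c + d)) + ln (fact (a + c))
      + ln (fact (b + d)) - ln (fact n) - ln (fact a) - ln (fact b) - ln (fact c) - ln (fact d)"
    by (simp add: ln_div ln_mult n_def)
  \<comment> \<open>The linear terms of Stirling's formula cancel: row totals and column totals each
    sum to \<open>n\<close>, and so do the cells. The terms \<open>k * ln k\<close> give the mutual
    information, and the half-logarithms give \<open>M\<close>, \<open>C\<close> and
    \<open>n\<close>.\<close>
  also have "\<dots> = - (real n * MI) + (ln M - ln C - ln (real n)) / 2 + G"
    unfolding MI unfolding ln_fact_eq_stirling_rem ln_M ln_C G_def of_nat_add n(2)
    by (simp add: field_simps)
  finally have eq: "ln (P_C (a, b, c, d)) = - (real n * MI) + (ln M - ln C - ln (real n)) / 2 + G" .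
  \<comment> \<open>As \<open>M / C\<close> lies between 1 and the square of \<open>n\<close>, the
    middle term is at most \<open>ln n / 2\<close> in absolute value.\<close>
  show ?lower ?upper
    using eq G \<open>ln C \<le> ln M\<close> \<open>ln M \<le> 2 * ln (real n) + ln C\<close> by argo+
qed

section \<open>Return to the frequencies and proof of the two inequalities\<close>

lemma obtain_positive_nat:
  fixes x :: real
  assumes "x > 0" "x \<in> \<int>"
  obtains m :: nat where "x = real m" "m > 0" "nat \<lfloor>x\<rfloor> = m"
proof -
  from assms obtain k :: int where k: "x = of_int k" by (elim Ints_cases)
  with assms have "k > 0" by simp
  then show ?thesis using k by (intro that[of "nat k"]) auto
qed

theorem mainTheorem3:
  fixes N :: nat and X0 X1 X2 X3 :: real
  assumes "N > 0"
    and "X0 > 0" and "X1 > 0" and "X2 > 0" and "X3 > 0"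
    and "X0 + X1 + X2 + X3 = 1"
    and "real N * X0 \<in> \<int>" and "real N * X1 \<in> \<int>"
    and "real N * X2 \<in> \<int>" and "real N * X3 \<in> \<int>"
  defines "obs \<equiv> (nat \<lfloor>real N * X0\<rfloor>, nat \<lfloor>real N * X1\<rfloor>,
                  nat \<lfloor>real N * X2\<rfloor>, nat \<lfloor>real N * X3\<rfloor>)"
    and "MI \<equiv> mutual_information X0 X1 X2 X3"
  shows "MI + 1 / real N * (- ln (real N + 1) - 3 / 2 * ln (real N + 1)
               + 1 / (12 * (real N + 1)) - 1 / (2 * real N) - 0.735)
           < - (1 / real N) * ln (P_F obs)
       \<and> - (1 / real N) * ln (P_F obs)
           < MI + 1 / (2 * real N) * ln (real N + 1) + 5.253 / real N"
proof -
  have N: "real N > 0" using assms(1) by simp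
  obtain a where a: "real N * X0 = real a" "a > 0" "nat \<lfloor>real N * X0\<rfloor> = a"
    using obtain_positive_nat[of "real N * X0"] N assms(2,7) by auto
  obtain b where b: "real N * X1 = real b" "b > 0" "nat \<lfloor>real N * X1\<rfloor> = b"
    using obtain_positive_nat[of "real N * X1"] N assms(3,8) by auto
  obtain c where c: "real N * X2 = real c" "c > 0" "nat \<lfloor>real N * X2\<rfloor> = c"
    using obtain_positive_nat[of "real N * X2"] N assms(4,9) by auto
  obtain d where d: "real N * X3 = real d" "d > 0" "nat \<lfloor>real N * X3\<rfloor> = d"
    using obtain_positive_nat[of "real N * X3"] N assms(5,10) by auto
  have obs: "obs = (a, b, c, d)"
    by (simp add: obs_def a b c d)
  have "real N = real N * (X0 + X1 + X2 + X3)" using assms(6) by simp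
  also have "\<dots> = real (a + b + c + d)"
    by (simp add: distrib_left a(1) b(1) c(1) d(1))
  finally have N_eq: "N = a + b + c + d" by (simp only: of_nat_eq_iff)
  have X: "X0 = real a / real N" "X1 = real b / real N" "X2 = real c / real N" "X3 = real d / real N"
    using N a(1) b(1) c(1) d(1) by (simp_all add: field_simps)
  have lower: "- (real N * MI) - ln (real N) / 2 - 2 \<le> ln (P_C obs)"
    and upper: "ln (P_C obs) \<le> - (real N * MI) + ln (real N) / 2 + 1 / 4"
    using ln_P_C_bounds[OF a(2) b(2) c(2) d(2)]
    unfolding N_eq[symmetric] obs MI_def X by blast+
  have "ln (P_C obs) \<le> ln (P_F obs)"
    using P_F_ge[of obs] P_C_pos[of obs] by simp
  moreover have ln_N: "ln (real N) < ln (real N + 1)" "0 \<le> ln (real N)"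
    using assms(1) by simp_all
  \<comment> \<open>The constant obtained is 2, well below 5.253.\<close>
  ultimately have "- ln (P_F obs) < real N * MI + 1 / 2 * ln (real N + 1) + 5.253"
    using lower by simp
  then have "- ln (P_F obs) / real N < (real N * MI + 1 / 2 * ln (real N + 1) + 5.253) / real N"
    using N by (rule divide_strict_right_mono)
  then have right: "- (1 / real N) * ln (P_F obs)
      < MI + 1 / (2 * real N) * ln (real N + 1) + 5.253 / real N"
    using N by (simp add: add_divide_distrib)
  have "total obs = N" by (simp add: obs N_eq)
  then have "ln (P_F obs) \<le> ln ((real N + 1) * P_C obs)"
    using P_F_le[of obs] P_F_ge[of obs] P_C_pos[of obs] by simp
  also have "\<dots> = ln (real N + 1) + ln (P_C obs)"
    using P_C_pos[of obs] by (simp add: ln_mult)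
  finally have "ln (P_F obs) \<le> ln (real N + 1) + ln (P_C obs)" .
  moreover have decimal: "(0.735 :: real) = 147 / 200" by simp
  moreover have "1 / (12 * (real N + 1)) \<le> 1 / 12" "0 \<le> 1 / (2 * real N)"
    using N by (simp_all add: divide_simps)
  \<comment> \<open>The losses are \<open>ln (N + 1)\<close> from counting tables and
    \<open>ln N / 2 + 1 / 4\<close> from Stirling. The logarithms stay within
    \<open>3 / 2 * ln (N + 1)\<close>, and 1/4 together with the positive term, at most 1/12, stays
    below 0.735.\<close>
  ultimately have "real N * MI + (- ln (real N + 1) - 3 / 2 * ln (real N + 1)
      + 1 / (12 * (real N + 1)) - 1 / (2 * real N) - 0.735) < - ln (P_F obs)"
    (is "_ + ?E < _")
    unfolding decimal using upper ln_N by argo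
  then have "(real N * MI + ?E) / real N < - ln (P_F obs) / real N"
    using N by (rule divide_strict_right_mono)
  then have left: "MI + 1 / real N * ?E < - (1 / real N) * ln (P_F obs)"
    using N by (simp add: add_divide_distrib)
  from left right show ?thesis ..
qed

end
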